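(* Let $G$ be a planar brace with at least six vertices, and let $n_3$ denote the number of vertices of $G$ of degree exactly $3$. Then $n_3 \ge 8$.
   Context: All graphs are simple. For $X \subseteq V(G)$, $\partial(X)$ denotes the set of edges with exactly one end in $X$; such a set is a cut, and it is trivial if $|X|=1$ or $|V(G)\setminus X|=1$. A connected graph $G$ is matching covered if every edge of $G$ lies in some perfect matching of $G$. A cut $C$ of a matching covered graph $G$ is tight if $|C \cap M| = 1$ for every perfect matching $M$ of $G$. A brace is a bipartite matching covered graph all of whose tight cuts are trivial. A planar brace is a brace that is a planar graph. *)

theory Defs
  imports "HOL-Analysis.Analysis"
begin

text \<open>A graph is given by its vertex set \<open>V\<close> and its edge set \<open>E\<close>, where an edge is the
  two-element set of its ends.\<close>

definition simple_graph :: "'a set \<Rightarrow> 'a set set \<Rightarrow> bool" where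
  "simple_graph V E \<longleftrightarrow> finite V \<and> (\<forall>e\<in>E. e \<subseteq> V \<and> card e = 2)"

definition connected_graph :: "'a set \<Rightarrow> 'a set set \<Rightarrow> bool" where
  "connected_graph V E \<longleftrightarrow>
     V \<noteq> {} \<and> (\<forall>u\<in>V. \<forall>v\<in>V. (u, v) \<in> {(x, y). {x, y} \<in> E}\<^sup>*)"

definition bipartite_graph :: "'a set \<Rightarrow> 'a set set \<Rightarrow> bool" where
  "bipartite_graph V E \<longleftrightarrow>
     (\<exists>A B. A \<union> B = V \<and> A \<inter> B = {} \<and> (\<forall>e\<in>E. \<exists>a\<in>A. \<exists>b\<in>B. e = {a, b}))"

definition vertex_degree :: "'a set set \<Rightarrow> 'a \<Rightarrow> nat" where
  "vertex_degree E v = card {e \<in> E. v \<in> e}"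

definition perfect_matching :: "'a set \<Rightarrow> 'a set set \<Rightarrow> 'a set set \<Rightarrow> bool" where
  "perfect_matching V E M \<longleftrightarrow> M \<subseteq> E \<and> (\<forall>v\<in>V. \<exists>!e. e \<in> M \<and> v \<in> e)"

definition matching_covered :: "'a set \<Rightarrow> 'a set set \<Rightarrow> bool" where
  "matching_covered V E \<longleftrightarrow>
     simple_graph V E \<and> connected_graph V E \<and>
     (\<forall>e\<in>E. \<exists>M. perfect_matching V E M \<and> e \<in> M)"

definition edge_boundary :: "'a set set \<Rightarrow> 'a set \<Rightarrow> 'a set set" where
  "edge_boundary E X = {e \<in> E. card (e \<inter> X) = 1}"

definition is_cut :: "'a set \<Rightarrow> 'a set set \<Rightarrow> 'a set set \<Rightarrow> bool" where
  "is_cut V E C \<longleftrightarrow> (\<exists>X\<subseteq>V. C = edge_boundary E X)"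

definition trivial_cut :: "'a set \<Rightarrow> 'a set set \<Rightarrow> 'a set set \<Rightarrow> bool" where
  "trivial_cut V E C \<longleftrightarrow>
     (\<exists>X\<subseteq>V. C = edge_boundary E X \<and> (card X = 1 \<or> card (V - X) = 1))"

definition tight_cut :: "'a set \<Rightarrow> 'a set set \<Rightarrow> 'a set set \<Rightarrow> bool" where
  "tight_cut V E C \<longleftrightarrow>
     is_cut V E C \<and> (\<forall>M. perfect_matching V E M \<longrightarrow> card (C \<inter> M) = 1)"

definition brace :: "'a set \<Rightarrow> 'a set set \<Rightarrow> bool" where
  "brace V E \<longleftrightarrow>
     matching_covered V E \<and> bipartite_graph V E \<and>
     (\<forall>C. tight_cut V E C \<longrightarrow> trivial_cut V E C)"

text \<open>A drawing in the plane (identified with \<open>\<complex>\<close>) puts each vertex \<open>v\<close> at the point \<open>p v\<close> and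
  represents each edge \<open>e\<close> by an arc \<open>\<gamma> e\<close>, that is, an injective continuous image of the unit
  interval. The third conjunct says that an edge passes through no vertex other than its ends, the
  fourth that two edges meet only at common ends.\<close>

definition plane_embedding ::
    "'a set \<Rightarrow> 'a set set \<Rightarrow> ('a \<Rightarrow> complex) \<Rightarrow> ('a set \<Rightarrow> real \<Rightarrow> complex) \<Rightarrow> bool" where
  "plane_embedding V E p \<gamma> \<longleftrightarrow>
     inj_on p V \<and>
     (\<forall>e\<in>E. arc (\<gamma> e) \<and> {pathstart (\<gamma> e), pathfinish (\<gamma> e)} = p ` e) \<and>
     (\<forall>e\<in>E. path_image (\<gamma> e) \<inter> p ` V = p ` e) \<and>
     (\<forall>e\<in>E. \<forall>f\<in>E. e \<noteq> f \<longrightarrow> path_image (\<gamma> e) \<inter> path_image (\<gamma> f) = p ` (e \<inter> f))"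

definition planar_graph :: "'a set \<Rightarrow> 'a set set \<Rightarrow> bool" where
  "planar_graph V E \<longleftrightarrow> (\<exists>p \<gamma>. plane_embedding V E p \<gamma>)"

definition planar_brace :: "'a set \<Rightarrow> 'a set set \<Rightarrow> bool" where
  "planar_brace V E \<longleftrightarrow> brace V E \<and> planar_graph V E"

end

theory Submission
  imports Defs
begin

text \<open>A bipartite connected plane graph with \<open>n \<ge> 3\<close> vertices and \<open>e\<close> edges has \<open>e \<le> 2n - 4\<close>: every
  face is incident with at least four edges, every edge with at most two faces, and there are at
  least \<open>e - n + 2\<close> faces, since each edge outside a spanning tree closes a cycle and, by the Jordan
  curve theorem, splits a face. In a brace with at least six vertices a vertex of degree two would
  form a nontrivial tight cut together with its two neighbours, so all degrees are at least three.
  Summing degrees, \<open>4n - n\<^sub>3 \<le> 2e \<le> 4n - 8\<close>.\<close>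

section \<open>Arcs and complementary components\<close>

definition arc_interior :: "(real \<Rightarrow> complex) \<Rightarrow> complex set" where
  "arc_interior g = path_image g - {pathstart g, pathfinish g}"

lemma arc_interior_nonempty:
  assumes "arc g"
  shows "arc_interior g \<noteq> {}"
  using assms nonempty_simple_path_endless arc_imp_simple_path
  unfolding arc_interior_def by blast

lemma arc_interior_in_component:
  assumes "arc g" "path_image g \<inter> K \<subseteq> {pathstart g, pathfinish g}"
  obtains F where "F \<in> components (- K)" "arc_interior g \<subseteq> F"
proof -
  have "connected (arc_interior g)"
    using assms(1) connected_simple_path_endless arc_imp_simple_path
    unfolding arc_interior_def by blast
  moreover have "arc_interior g \<subseteq> - K"
    using assms(2) by (auto simp: arc_interior_def)
  ultimately show ?thesis
    using that arc_interior_nonempty[OF assms(1)]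
    by (metis Int_empty_right components_eq_empty exists_component_superset inf.orderE)
qed

text \<open>A path-connected subset of the plane is arcwise connected, so the ends of
  \<open>g\<close> are joined by an arc inside \<open>K\<close>. By the hypothesis on
  \<open>g\<close> and \<open>K\<close> the two arcs meet only at their ends and form a Jordan
  curve.\<close>

lemma arc_completes_to_cycle:
  fixes g :: "real \<Rightarrow> complex"
  assumes "arc g" "path_image g \<inter> K \<subseteq> {pathstart g, pathfinish g}"
    and "path_component K (pathstart g) (pathfinish g)"
  obtains h where "arc h" "path_image h \<subseteq> K" "pathstart h = pathfinish g" "pathfinish h = pathstart g"
    "simple_path (g +++ h)" "path_image (g +++ h) = path_image g \<union> path_image h"
proof -
  let ?P = "path_component_set K (pathstart g)"
  have "pathstart g \<in> ?P" "pathfinish g \<in> ?P"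
    using assms(3) path_component_mem(1) by (auto intro!: path_component_refl)
  moreover have "pathstart g \<noteq> pathfinish g"
    using assms(1) arc_distinct_ends by metis
  moreover have "path_connected ?P" by simp
  ultimately obtain h where h: "arc h" "path_image h \<subseteq> ?P" "pathstart h = pathfinish g"
      "pathfinish h = pathstart g"
    unfolding path_connected_arcwise by metis
  have hK: "path_image h \<subseteq> K"
    using h(2) path_component_subset by blast
  have "simple_path (g +++ h)"
    using simple_path_join_loop[OF assms(1) h(1)] h hK assms(2) by auto
  moreover have "path_image (g +++ h) = path_image g \<union> path_image h"
    using h by (simp add: path_image_join)
  ultimately show ?thesis using that h hK by blast
qed

text \<open>Closing the arc up inside \<open>K\<close> gives a Jordan curve. An interior point of
  \<open>g\<close> lies on the frontier of both sides of the curve, so the open set \<open>F\<close>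
  contains points of both sides, and a connected set that avoids the curve cannot contain two such
  points.\<close>

lemma arc_separates_component:
  fixes g :: "real \<Rightarrow> complex"
  assumes "closed K" "arc g" "path_image g \<inter> K \<subseteq> {pathstart g, pathfinish g}"
    and "path_component K (pathstart g) (pathfinish g)"
    and F: "F \<in> components (- K)" "arc_interior g \<subseteq> F"
  obtains W W' where "W \<noteq> W'" "W \<subseteq> F" "W' \<subseteq> F"
    "W \<in> components (- (K \<union> path_image g))" "W' \<in> components (- (K \<union> path_image g))"
proof -
  obtain h where h: "arc h" "path_image h \<subseteq> K" "pathstart h = pathfinish g"
      "pathfinish h = pathstart g" "simple_path (g +++ h)"
      and im: "path_image (g +++ h) = path_image g \<union> path_image h"
    using arc_completes_to_cycle assms by metis
  let ?c = "path_image (g +++ h)"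
  have J: "inside ?c \<inter> outside ?c = {}" "inside ?c \<union> outside ?c = - ?c"
     "open (inside ?c)" "open (outside ?c)"
     "frontier (inside ?c) = ?c" "frontier (outside ?c) = ?c"
    using Jordan_inside_outside[OF h(5)] h by auto
  obtain x where x: "x \<in> arc_interior g"
    using arc_interior_nonempty assms by blast
  have xc: "x \<in> ?c" using x im by (auto simp: arc_interior_def)
  have "open F" using F assms(1) open_components by blast
  have FK: "F \<subseteq> - K" using F in_components_subset by blast
  have meet: "\<exists>a. a \<in> F \<inter> S" if "x \<in> frontier S" for S
  proof -
    have "x \<in> closure S" using that by (simp add: frontier_def)
    moreover have "x \<in> F" using x F(2) by blast
    ultimately have "F \<inter> S \<noteq> {}"
      using \<open>open F\<close> open_Int_closure_eq_empty by blast
    then show ?thesis by blast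
  qed
  obtain a where a: "a \<in> F" "a \<in> inside ?c" using meet xc J by blast
  obtain b where b: "b \<in> F" "b \<in> outside ?c" using meet xc J by blast
  let ?L = "- (K \<union> path_image g)"
  have "a \<in> ?L" "b \<in> ?L" using a b FK J im by blast+
  have sub: "connected_component_set ?L z \<subseteq> F" if "z \<in> F" "z \<in> ?L" for z
  proof (rule components_maximal[OF F(1)])
    show "connected_component_set ?L z \<subseteq> - K"
      using connected_component_subset by blast
    show "F \<inter> connected_component_set ?L z \<noteq> {}"
      using that connected_component_refl by fastforce
  qed auto
  have "connected_component_set ?L a \<noteq> connected_component_set ?L b"
  proof
    let ?W = "connected_component_set ?L a"
    assume "?W = connected_component_set ?L b"
    then have ab: "a \<in> ?W" "b \<in> ?W"
      using \<open>a \<in> ?L\<close> \<open>b \<in> ?L\<close> connected_component_refl by (metis mem_Collect_eq)+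
    have "?W \<subseteq> inside ?c \<union> outside ?c"
      using connected_component_subset[of ?L a] J(2) h(2) im by blast
    then show False
      using connectedD[OF connected_connected_component[of ?L a] J(3,4)] J(1) ab a b by blast
  qed
  then show ?thesis
    using that[OF _ sub sub] a b \<open>a \<in> ?L\<close> \<open>b \<in> ?L\<close> by (simp add: componentsI)
qed

text \<open>If the ends of the arc are joined in \<open>K\<close>, the arc lies on a cycle whose two sides separate
  at most two of the three points, and Janiszewski's theorem applies to the cycle and \<open>K\<close>, whose
  intersection is an arc. Otherwise \<open>K\<close> splits into two parts that meet the arc in at most one
  point each.\<close>

lemma arc_at_most_two_sides:
  fixes g :: "real \<Rightarrow> complex"
  assumes \<K>: "finite \<K>" "\<And>C. C \<in> \<K> \<Longrightarrow> compact C" "\<And>C. C \<in> \<K> \<Longrightarrow> path_connected C"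
    and "arc g" "path_image g \<inter> \<Union>\<K> \<subseteq> {pathstart g, pathfinish g}"
    and "connected_component (- \<Union>\<K>) a b" "connected_component (- \<Union>\<K>) a c"
    and "a \<notin> path_image g" "b \<notin> path_image g" "c \<notin> path_image g"
  shows "connected_component (- (\<Union>\<K> \<union> path_image g)) a b \<or>
         connected_component (- (\<Union>\<K> \<union> path_image g)) a c \<or>
         connected_component (- (\<Union>\<K> \<union> path_image g)) b c"
proof -
  let ?K = "\<Union>\<K>"
  have K: "compact ?K" using \<K>(1,2) by (rule compact_Union)
  have abc: "a \<in> - ?K" "b \<in> - ?K" "c \<in> - ?K"
    using connected_component_in assms(6,7) by metis+
  have bc: "connected_component (- ?K) b c"
    using assms(6,7) connected_component_trans connected_component_sym by blast
  show ?thesis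
  proof (cases "path_component ?K (pathstart g) (pathfinish g)")
    case True
    then obtain h where h: "arc h" "path_image h \<subseteq> ?K" "pathstart h = pathfinish g"
      "pathfinish h = pathstart g" "simple_path (g +++ h)"
      and im: "path_image (g +++ h) = path_image g \<union> path_image h"
      using arc_completes_to_cycle assms by metis
    let ?c = "path_image (g +++ h)"
    have J: "inside ?c \<inter> outside ?c = {}" "inside ?c \<union> outside ?c = - ?c"
      "connected (inside ?c)" "connected (outside ?c)"
      using Jordan_inside_outside[OF h(5)] h by auto
    have "{pathstart g, pathfinish g} \<subseteq> path_image h"
      using h(3,4) pathfinish_in_path_image pathstart_in_path_image by (metis insert_subset empty_subsetI)
    then have int: "?c \<inter> ?K = path_image h"
      using assms(5) h(2) im by blast
    have un: "?c \<union> ?K = ?K \<union> path_image g"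
      using h(2) im by blast
    have side: "connected_component (- (?K \<union> path_image g)) y z"
      if "{y, z} \<subseteq> inside ?c \<or> {y, z} \<subseteq> outside ?c" "connected_component (- ?K) y z" for y z
    proof -
      have "connected_component (- ?c) y z"
        unfolding connected_component_def using that(1) J by blast
      moreover have "compact ?c"
        using h(5) compact_simple_path_image by blast
      moreover have "connected (?c \<inter> ?K)"
        using int h(1) connected_arc_image by simp
      ultimately show ?thesis
        using Janiszewski[of ?c ?K y z] that(2) K compact_imp_closed un by metis
    qed
    have "{a, b, c} \<subseteq> inside ?c \<union> outside ?c"
      using abc assms(8-10) h(2) J(2) im by blast
    then show ?thesis
      using side bc assms(6,7) by blast
  next
    case False
    let ?P = "path_component_set ?K (pathstart g)"
    \<comment> \<open>Path components of a compact set need not be closed. Sorting the finitely many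
      members of \<open>\<K>\<close>, each of which lies inside \<open>?P\<close> or misses it,
      keeps both parts compact.\<close>
    define K1 where "K1 = \<Union>{C \<in> \<K>. C \<subseteq> ?P}"
    define K2 where "K2 = \<Union>{C \<in> \<K>. \<not> C \<subseteq> ?P}"
    have K12: "?K = K1 \<union> K2" by (auto simp: K1_def K2_def)
    have "compact K1" "compact K2" using \<K>(1,2) unfolding K1_def K2_def by (auto intro!: compact_Union)
    have disj: "C \<inter> ?P = {}" if "C \<in> \<K>" "\<not> C \<subseteq> ?P" for C
    proof (rule ccontr)
      assume "C \<inter> ?P \<noteq> {}"
      then obtain y where y: "y \<in> C" "y \<in> ?P" by blast
      have "C \<subseteq> path_component_set ?K y"
        using path_component_maximal \<K>(3) that(1) y(1) by blast
      moreover have "path_component_set ?K y = ?P"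
        using y(2) path_component_eq by blast
      ultimately show False using that(2) by simp
    qed
    have K1: "K1 \<subseteq> ?P" and K2: "K2 \<inter> ?P = {}"
      using disj by (auto simp: K1_def K2_def)
    have "pathfinish g \<notin> K1" using K1 False by blast
    have "pathstart g \<notin> K2"
    proof
      assume "pathstart g \<in> K2"
      then have "pathstart g \<in> ?P" using K12 path_component_refl by blast
      then show False using K2 \<open>pathstart g \<in> K2\<close> by blast
    qed
    have small: "connected T" if "T \<subseteq> {z}" for T :: "complex set" and z
      using that by (metis connected_empty connected_sing subset_singletonD)
    have 1: "connected (path_image g \<inter> K1)"
      using small[of "path_image g \<inter> K1" "pathstart g"] assms(5) \<open>pathfinish g \<notin> K1\<close> K12 by blast
    have "(path_image g \<union> K1) \<inter> K2 \<subseteq> {pathfinish g}"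
      using assms(5) \<open>pathstart g \<notin> K2\<close> K12 K1 K2 by blast
    then have 2: "connected ((path_image g \<union> K1) \<inter> K2)"
      using small by blast
    have cg: "compact (path_image g)" using assms(4) compact_arc_image by blast
    have sub: "connected_component (- K1) a b" "connected_component (- K2) a b"
      using assms(6) K12 connected_component_of_subset[of "- ?K"] by (metis Compl_anti_mono sup_ge1 sup_ge2)+
    \<comment> \<open>An arc does not separate the plane. \<open>K1\<close> and then
      \<open>K2\<close> are added by Janiszewski's theorem, each meeting what is already there in at
      most one point, so in this case \<open>a\<close> and \<open>b\<close> themselves stay
      together.\<close>
    have "connected (- path_image g)"
      using connected_arc_complement[OF assms(4)] by simp
    then have "connected_component (- path_image g) a b"
      using assms(8,9) by (simp add: connected_iff_connected_component)
    then have "connected_component (- (path_image g \<union> K1)) a b"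
      using Janiszewski[OF cg _ 1] sub \<open>compact K1\<close> compact_imp_closed by blast
    then have "connected_component (- (path_image g \<union> K1 \<union> K2)) a b"
      using Janiszewski[OF _ _ 2] sub \<open>compact K1\<close> \<open>compact K2\<close> cg compact_imp_closed compact_Un by blast
    then show ?thesis by (simp add: K12 Un_ac)
  qed
qed

section \<open>Degrees in braces\<close>

lemma rtrancl_leaves_set:
  assumes "(u, v) \<in> r\<^sup>*" "u \<in> U" "v \<notin> U"
  obtains x y where "(x, y) \<in> r" "x \<in> U" "y \<notin> U"
  using assms by (induction rule: rtrancl_induct) blast+

lemma connected_graph_edge_leaving:
  assumes "simple_graph V E" "connected_graph V E" "U \<subseteq> V" "U \<noteq> {}" "U \<noteq> V"
  obtains x y where "{x, y} \<in> E" "x \<in> U" "y \<in> V - U"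
proof -
  obtain u v where uv: "u \<in> U" "v \<in> V" "v \<notin> U"
    using assms by blast
  then have "(u, v) \<in> {(x, y). {x, y} \<in> E}\<^sup>*"
    using assms(2,3) unfolding connected_graph_def by blast
  then obtain x y where "{x, y} \<in> E" "x \<in> U" "y \<notin> U"
    using rtrancl_leaves_set[of u v _ U] uv by blast
  then show ?thesis
    using that assms(1) unfolding simple_graph_def by blast
qed

lemma simple_graph_edgeE:
  assumes "simple_graph V E" "e \<in> E" "v \<in> e"
  obtains w where "e = {v, w}" "w \<noteq> v" "v \<in> V" "w \<in> V"
proof -
  have "card e = 2" "e \<subseteq> V" using assms unfolding simple_graph_def by auto
  then obtain x y where "e = {x, y}" "x \<noteq> y" by (auto simp: card_2_iff)
  then show ?thesis using that assms(3) \<open>e \<subseteq> V\<close> by auto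
qed

lemma simple_graph_finite_edges:
  assumes "simple_graph V E"
  shows "finite E"
proof -
  have "E \<subseteq> Pow V" "finite V" using assms unfolding simple_graph_def by auto
  then show ?thesis using finite_subset by blast
qed

lemma handshake:
  assumes "simple_graph V E"
  shows "(\<Sum>v\<in>V. vertex_degree E v) = 2 * card E"
proof -
  have fin: "finite V" "finite E"
    using assms simple_graph_finite_edges unfolding simple_graph_def by auto
  have "(\<Sum>v\<in>V. vertex_degree E v) = (\<Sum>v\<in>V. \<Sum>e | e \<in> E \<and> v \<in> e. 1)"
    by (simp add: vertex_degree_def)
  also have "\<dots> = (\<Sum>e\<in>E. \<Sum>v | v \<in> V \<and> v \<in> e. 1)"
    using sum.swap_restrict[OF fin] by fast
  also have "\<dots> = (\<Sum>e\<in>E. 2)"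
  proof (rule sum.cong[OF refl])
    fix e assume "e \<in> E"
    then have "{v. v \<in> V \<and> v \<in> e} = e" "card e = 2"
      using assms unfolding simple_graph_def by auto
    then show "(\<Sum>v | v \<in> V \<and> v \<in> e. 1) = (2::nat)" by simp
  qed
  finally show ?thesis by simp
qed

lemma edge_in_boundary_iff:
  assumes "x \<noteq> y" "{x, y} \<in> E"
  shows "{x, y} \<in> edge_boundary E X \<longleftrightarrow> (x \<in> X) \<noteq> (y \<in> X)"
  using assms by (cases "x \<in> X"; cases "y \<in> X") (auto simp: edge_boundary_def)

text \<open>An edge leaving the set \<open>?U\<close> on which \<open>X\<close> and \<open>Y\<close>
  agree would lie in exactly one of the two boundaries, so connectedness makes \<open>?U\<close>
  empty or all of \<open>V\<close>. This recovers the two shores of a cut, which is given only as an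
  edge set.\<close>

lemma connected_boundary_eq:
  assumes G: "simple_graph V E" "connected_graph V E"
    and "X \<subseteq> V" "Y \<subseteq> V" "edge_boundary E X = edge_boundary E Y"
  shows "Y = X \<or> Y = V - X"
proof (rule ccontr)
  let ?U = "{x \<in> V. x \<in> X \<longleftrightarrow> x \<in> Y}"
  assume "\<not> ?thesis"
  then have "?U \<noteq> {}" "?U \<noteq> V" using assms(3,4) by blast+
  then obtain x y where xy: "{x, y} \<in> E" "x \<in> ?U" "y \<in> V - ?U"
    using connected_graph_edge_leaving[OF G, of ?U] by blast
  then have "x \<noteq> y" by blast
  then have "((x \<in> X) \<noteq> (y \<in> X)) = ((x \<in> Y) \<noteq> (y \<in> Y))"
    using edge_in_boundary_iff xy(1) assms(5) by metis
  then show False using xy(2,3) by auto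
qed

section \<open>Perfect matchings and vertex degrees\<close>

lemma perfect_matching_unique:
  assumes "perfect_matching V E M" "v \<in> V" "e \<in> M" "f \<in> M" "v \<in> e" "v \<in> f"
  shows "e = f"
proof -
  have "\<exists>!g. g \<in> M \<and> v \<in> g"
    using assms(1,2) unfolding perfect_matching_def by simp
  then show ?thesis using assms(3-6) by blast
qed

lemma perfect_matchingE:
  assumes "perfect_matching V E M" "v \<in> V"
  obtains e where "e \<in> M" "e \<in> E" "v \<in> e"
  using assms unfolding perfect_matching_def by blast

text \<open>If \<open>{v, u}\<close> were the only edge at \<open>v\<close>, it would lie in every
  perfect matching and so keep every other edge at \<open>u\<close> out of all of them.
  Connectedness and a third vertex supply such an edge at \<open>u\<close>.\<close>

lemma matching_covered_no_leaf:
  assumes mc: "matching_covered V E" and "card V \<ge> 3" and v: "v \<in> V"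
  shows "vertex_degree E v \<ge> 2"
proof -
  have G: "simple_graph V E" "connected_graph V E"
    using mc unfolding matching_covered_def by auto
  have "{v} \<noteq> V" using assms(2) by auto
  then obtain u where u: "{v, u} \<in> E" "u \<in> V" "u \<noteq> v"
    using connected_graph_edge_leaving[OF G, of "{v}"] v by blast
  have "card {v, u} \<le> 2" by (simp add: card_insert_le_m1)
  then have "{v, u} \<noteq> V" using assms(2) by auto
  then obtain x y where xy: "{x, y} \<in> E" "x \<in> {v, u}" "y \<in> V - {v, u}"
    using connected_graph_edge_leaving[OF G, of "{v, u}"] v u by blast
  have "\<exists>f\<in>E. v \<in> f \<and> f \<noteq> {v, u}"
  proof (rule ccontr)
    assume no: "\<not> ?thesis"
    then have "x = u" using xy by (auto simp: doubleton_eq_iff)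
    obtain M where M: "perfect_matching V E M" "{u, y} \<in> M"
      using mc xy(1) \<open>x = u\<close> unfolding matching_covered_def by blast
    then have "{v, u} \<in> M" using no v by (metis perfect_matchingE)
    then have "{v, u} = {u, y}"
      using perfect_matching_unique[OF M(1) u(2)] M(2) by blast
    then show False using xy u by (auto simp: doubleton_eq_iff)
  qed
  then obtain f where f: "f \<in> E" "v \<in> f" "f \<noteq> {v, u}" by blast
  have "finite {e \<in> E. v \<in> e}" using simple_graph_finite_edges[OF G(1)] by simp
  then have "card {{v, u}, f} \<le> card {e \<in> E. v \<in> e}"
    using u f by (intro card_mono) auto
  then show ?thesis using f by (simp add: vertex_degree_def)
qed

text \<open>A perfect matching covers a vertex \<open>v\<close> of degree two through one of its neighbours, so that
  only the other neighbour is matched to the outside of the closed neighbourhood of \<open>v\<close>.\<close>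

lemma degree_two_tight_cut:
  assumes G: "simple_graph V E"
    and nb: "{e \<in> E. v \<in> e} = {{v, u}, {v, w}}" and neq: "v \<noteq> u" "v \<noteq> w" "u \<noteq> w"
    and V: "{v, u, w} \<subseteq> V"
  shows "tight_cut V E (edge_boundary E {v, u, w})"
proof -
  \<comment> \<open>Here \<open>a\<close> is the neighbour matched to \<open>v\<close>. The matching
    edge \<open>f\<close> at \<open>b\<close> then cannot end in \<open>v\<close> or
    \<open>a\<close>, so it lies in the cut, and it is the only matching edge there. Both choices of
    \<open>a\<close> occur below.\<close>
  have *: "card (edge_boundary E {v, a, b} \<inter> M) = 1"
    if M: "perfect_matching V E M" and vM: "{v, a} \<in> M"
      and ab: "v \<noteq> a" "v \<noteq> b" "a \<noteq> b" "{v, a, b} \<subseteq> V" for M a b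
  proof -
    obtain f where f: "f \<in> M" "f \<in> E" "b \<in> f"
      using perfect_matchingE[OF M, of b] ab by blast
    obtain z where z: "f = {b, z}" "z \<noteq> b"
      using simple_graph_edgeE[OF G f(2,3)] by blast
    have uniq: "g = {v, a}" if "g \<in> M" "v \<in> g \<or> a \<in> g" for g
      using perfect_matching_unique[OF M _ that(1) vM] that(2) ab by blast
    have "z \<noteq> v" "z \<noteq> a"
      using uniq[OF f(1)] z ab by (auto simp: doubleton_eq_iff)
    then have "f \<inter> {v, a, b} = {b}" using z ab by auto
    then have fb: "f \<in> edge_boundary E {v, a, b}"
      using f by (simp add: edge_boundary_def)
    have "g = f" if g: "g \<in> edge_boundary E {v, a, b}" "g \<in> M" for g
    proof -
      have "g \<inter> {v, a, b} \<noteq> {}"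
        using g(1) unfolding edge_boundary_def by force
      moreover have "g \<noteq> {v, a}"
      proof
        assume "g = {v, a}"
        then have "g \<inter> {v, a, b} = {v, a}" by auto
        then show False using g(1) ab by (simp add: edge_boundary_def)
      qed
      ultimately have "b \<in> g" using uniq g(2) by blast
      then show ?thesis using perfect_matching_unique[OF M _ g(2) f(1)] f(3) ab by blast
    qed
    then have "edge_boundary E {v, a, b} \<inter> M = {f}" using fb f by blast
    then show ?thesis by simp
  qed
  have "card (edge_boundary E {v, u, w} \<inter> M) = 1" if M: "perfect_matching V E M" for M
  proof -
    obtain e where e: "e \<in> M" "e \<in> E" "v \<in> e" using perfect_matchingE[OF M, of v] V by blast
    then have "e \<in> {{v, u}, {v, w}}" by (simp flip: nb)
    then consider "{v, u} \<in> M" | "{v, w} \<in> M" using e(1) by auto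
    then show ?thesis
    proof cases
      case 1
      then show ?thesis using *[OF M 1] neq V by blast
    next
      case 2
      moreover have "{v, w, u} = {v, u, w}" by auto
      ultimately show ?thesis using *[OF M 2, of u] neq V by simp
    qed
  qed
  then show ?thesis using V unfolding tight_cut_def is_cut_def by blast
qed

lemma brace_min_degree:
  assumes "brace V E" "card V \<ge> 6" and v: "v \<in> V"
  shows "vertex_degree E v \<ge> 3"
proof (rule ccontr)
  have mc: "matching_covered V E" using assms(1) unfolding brace_def by simp
  then have G: "simple_graph V E" "connected_graph V E"
    unfolding matching_covered_def by auto
  assume "\<not> ?thesis"
  then have "card {e \<in> E. v \<in> e} = 2"
    using matching_covered_no_leaf[OF mc _ v] assms(2) by (simp add: vertex_degree_def)
  then obtain e f where ef: "{e \<in> E. v \<in> e} = {e, f}" "e \<noteq> f"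
    by (auto simp: card_2_iff)
  obtain u where u: "e = {v, u}" "u \<noteq> v" "u \<in> V"
    using simple_graph_edgeE[OF G(1), of e v] ef(1) by blast
  obtain w where w: "f = {v, w}" "w \<noteq> v" "w \<in> V"
    using simple_graph_edgeE[OF G(1), of f v] ef(1) by blast
  let ?X = "{v, u, w}"
  have uw: "u \<noteq> w" using u w ef by blast
  have X: "?X \<subseteq> V" "card ?X = 3" using u w v uw by auto
  have "tight_cut V E (edge_boundary E ?X)"
    using degree_two_tight_cut[OF G(1), of v u w] ef u w uw X by blast
  then have "trivial_cut V E (edge_boundary E ?X)"
    using assms(1) unfolding brace_def by blast
  then obtain Y where Y: "Y \<subseteq> V" "edge_boundary E ?X = edge_boundary E Y"
      "card Y = 1 \<or> card (V - Y) = 1"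
    unfolding trivial_cut_def by blast
  \<comment> \<open>The singleton shore witnessing triviality must be \<open>?X\<close> or its
    complement, but these have three and \<open>card V - 3 \<ge> 3\<close> vertices.\<close>
  have "Y = ?X \<or> Y = V - ?X"
    using connected_boundary_eq[OF G X(1) Y(1,2)] .
  moreover have "card (V - ?X) = card V - 3"
    using X G(1) by (metis card_Diff_subset finite_subset simple_graph_def)
  moreover have "V - (V - ?X) = ?X" using X by blast
  ultimately show False using Y(3) X(2) assms(2) by auto
qed

text \<open>If every end of every edge is shared with another edge, an edge \<open>{a, b}\<close>
  extends to a walk \<open>a1, b, a, b', a2\<close>. Its four edges are distinct, even when
  \<open>a1 = a2\<close> closes it to a four-cycle. Bipartiteness enters the edge bound through this
  lemma.\<close>

lemma bipartite_three_edges_leaf: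
  assumes "finite S" "S \<noteq> {}" "card S \<le> 3" "A \<inter> B = {}"
    and S: "\<forall>e\<in>S. \<exists>a\<in>A. \<exists>b\<in>B. e = {a, b}"
  shows "\<exists>e\<in>S. \<exists>x\<in>e. x \<notin> \<Union>(S - {e})"
proof (rule ccontr)
  assume "\<not> ?thesis"
  then have no: "\<forall>e\<in>S. \<forall>x\<in>e. \<exists>f\<in>S. f \<noteq> e \<and> x \<in> f"
    by blast
  have other_B: "\<exists>b'\<in>B. {a, b'} \<in> S \<and> b' \<noteq> b" if ab: "{a, b} \<in> S" "a \<in> A" for a b
  proof -
    obtain f where f: "f \<in> S" "f \<noteq> {a, b}" "a \<in> f" using no ab(1) by blast
    obtain c d where cd: "f = {c, d}" "c \<in> A" "d \<in> B" using S f(1) by blast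
    have "a \<notin> B" using ab(2) assms(4) by blast
    then have "c = a" using cd f(3) by auto
    then show ?thesis using f cd by blast
  qed
  have other_A: "\<exists>a'\<in>A. {a', b} \<in> S \<and> a' \<noteq> a" if ab: "{a, b} \<in> S" "b \<in> B" for a b
  proof -
    obtain f where f: "f \<in> S" "f \<noteq> {a, b}" "b \<in> f" using no ab(1) by blast
    obtain c d where cd: "f = {c, d}" "c \<in> A" "d \<in> B" using S f(1) by blast
    have "b \<notin> A" using ab(2) assms(4) by blast
    then have "d = b" using cd f(3) by auto
    then show ?thesis using f cd by blast
  qed
  obtain e where e: "e \<in> S" using assms(2) by blast
  then obtain a b where "e = {a, b}" "a \<in> A" "b \<in> B" using S by blast
  then have e1: "{a, b} \<in> S" "a \<in> A" "b \<in> B" using e by auto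
  obtain b' where e2: "b' \<in> B" "{a, b'} \<in> S" "b' \<noteq> b" using other_B[OF e1(1,2)] by blast
  obtain a1 where a1: "a1 \<in> A" "{a1, b} \<in> S" "a1 \<noteq> a" using other_A[OF e1(1,3)] by blast
  obtain a2 where a2: "a2 \<in> A" "{a2, b'} \<in> S" "a2 \<noteq> a" using other_A[OF e2(2,1)] by blast
  have AB: "x \<noteq> y" if "x \<in> A" "y \<in> B" for x y
    using that assms(4) by blast
  note ne = AB[OF e1(2,3)] AB[OF a1(1) e1(3)] AB[OF a2(1) e1(3)]
    AB[OF e1(2) e2(1)] AB[OF a1(1) e2(1)] AB[OF a2(1) e2(1)]
  have "card {{a, b}, {a, b'}, {a1, b}, {a2, b'}} = 4"
    using ne e2(3) a1(3) a2(3) by (simp add: doubleton_eq_iff card_insert_if)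
  moreover have "{{a, b}, {a, b'}, {a1, b}, {a2, b'}} \<subseteq> S"
    using e1(1) e2(2) a1(2) a2(2) by simp
  then have "card {{a, b}, {a, b'}, {a1, b}, {a2, b'}} \<le> 3"
    using card_mono[OF assms(1)] assms(3) order_trans by metis
  ultimately show False by simp
qed

section \<open>Faces of plane graphs\<close>

text \<open>A connected set that properly contains \<open>W\<close> meets the frontier of
  \<open>W\<close>. Hence \<open>W\<close> stays maximal when \<open>K\<close> shrinks to any subset
  that still contains this frontier.\<close>

lemma component_avoiding_frontier:
  assumes "W \<in> components (- K)" "L \<subseteq> K" "frontier W \<subseteq> L"
  shows "W \<in> components (- L)"
  unfolding in_components_maximal
proof (intro conjI allI impI)
  have W: "W \<noteq> {}" "connected W" "W \<subseteq> - K"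
    using assms(1) in_components_nonempty in_components_connected in_components_subset by blast+
  then show "W \<noteq> {}" "connected W" "W \<subseteq> - L" using assms(2) by auto
  fix D assume D: "D \<noteq> {} \<and> W \<subseteq> D \<and> D \<subseteq> - L \<and> connected D"
  then have "D \<inter> frontier W = {}" using assms(3) by blast
  then show "D = W" using connected_Int_frontier[of D W] D W by blast
qed

text \<open>Finiteness is part of the conclusion because \<open>card\<close> is 0 on infinite
  sets.\<close>

lemma card_le_2I:
  assumes "\<And>x y z. x \<in> A \<Longrightarrow> y \<in> A \<Longrightarrow> z \<in> A \<Longrightarrow> x = y \<or> x = z \<or> y = z"
  shows "finite A \<and> card A \<le> 2"
proof (rule ccontr)
  assume neg: "\<not> ?thesis"
  have "\<exists>T\<subseteq>A. card T = 3"
  proof (cases "finite A")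
    case True
    with neg have "3 \<le> card A" by simp
    then show ?thesis using obtain_subset_with_card_n by metis
  next
    case False
    then show ?thesis using infinite_arbitrarily_large by metis
  qed
  then obtain T x y z where "T \<subseteq> A" "T = {x, y, z}" "x \<noteq> y" "x \<noteq> z" "y \<noteq> z"
    by (auto simp: card_3_iff)
  then show False using assms[of x y z] by blast
qed

section \<open>Drawings of edge sets and incidence with faces\<close>

locale plane_graph =
  fixes V :: "'a set" and E :: "'a set set" and p :: "'a \<Rightarrow> complex"
    and \<gamma> :: "'a set \<Rightarrow> real \<Rightarrow> complex"
  assumes simple: "simple_graph V E"
    and embedding: "plane_embedding V E p \<gamma>"
begin

definition drawing :: "'a set set \<Rightarrow> complex set" where
  "drawing S = (\<Union>e\<in>S. path_image (\<gamma> e))"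

text \<open>Vertex points are not removed separately; where this matters,
  \<open>V \<subseteq> \<Union>E\<close> is assumed, which puts all of them on edges.\<close>

definition faces :: "complex set set" where
  "faces = components (- drawing E)"

text \<open>Incidence is tested on the frontier of the face alone, so that a face of the whole graph keeps
  its set of incident edges when it is viewed as a face of a subgraph.\<close>

definition face_edges :: "complex set \<Rightarrow> 'a set set" where
  "face_edges W = {e \<in> E. frontier W \<inter> arc_interior (\<gamma> e) \<noteq> {}}"

lemma finite_V: "finite V" and finite_E: "finite E"
  using simple simple_graph_finite_edges unfolding simple_graph_def by auto

lemma finite_subset_E: "S \<subseteq> E \<Longrightarrow> finite S"
  using finite_E finite_subset by blast

lemma edge_subset: "e \<in> E \<Longrightarrow> e \<subseteq> V"
  using simple unfolding simple_graph_def by blast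

lemma edge_arc:
  assumes "e \<in> E"
  shows "arc (\<gamma> e)" and "{pathstart (\<gamma> e), pathfinish (\<gamma> e)} = p ` e"
    and "path_image (\<gamma> e) \<inter> p ` V = p ` e"
  using assms embedding unfolding plane_embedding_def by simp_all

lemma edge_Int_edge:
  assumes "e \<in> E" "f \<in> E" "e \<noteq> f"
  shows "path_image (\<gamma> e) \<inter> path_image (\<gamma> f) = p ` (e \<inter> f)"
  using assms embedding unfolding plane_embedding_def by simp

lemma arc_interior_edge: "e \<in> E \<Longrightarrow> arc_interior (\<gamma> e) = path_image (\<gamma> e) - p ` e"
  using edge_arc unfolding arc_interior_def by simp

lemma edge_compact: "e \<in> E \<Longrightarrow> compact (path_image (\<gamma> e))"
  using edge_arc(1) compact_arc_image by blast

lemma edge_path_connected: "e \<in> E \<Longrightarrow> path_connected (path_image (\<gamma> e))"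
  using edge_arc(1) arc_imp_path path_connected_path_image by blast

lemma ends_in_edge: "e \<in> E \<Longrightarrow> p ` e \<subseteq> path_image (\<gamma> e)"
  using edge_arc(3) by blast

lemma compact_drawing: "S \<subseteq> E \<Longrightarrow> compact (drawing S)"
  unfolding drawing_def using edge_compact finite_subset_E by (intro compact_UN) auto

lemma drawing_insert [simp]: "drawing (insert e S) = path_image (\<gamma> e) \<union> drawing S"
  and drawing_empty [simp]: "drawing {} = {}"
  by (auto simp: drawing_def)

lemma edge_Int_drawing:
  assumes "e \<in> E" "S \<subseteq> E" "e \<notin> S"
  shows "path_image (\<gamma> e) \<inter> drawing S = p ` (e \<inter> \<Union>S)"
proof -
  have "path_image (\<gamma> e) \<inter> path_image (\<gamma> f) = p ` (e \<inter> f)" if "f \<in> S" for f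
    using edge_Int_edge[of e f] that assms by blast
  then show ?thesis unfolding drawing_def by blast
qed

lemma edge_Int_others:
  assumes "e \<in> E" "S \<subseteq> E" "e \<notin> S"
  shows "path_image (\<gamma> e) \<inter> (p ` V \<union> drawing S) \<subseteq> {pathstart (\<gamma> e), pathfinish (\<gamma> e)}"
  unfolding Int_Un_distrib edge_Int_drawing[OF assms] edge_arc(2,3)[OF assms(1)] by auto

lemma drawing_eq_interiors:
  assumes "S \<subseteq> E"
  shows "drawing S \<subseteq> p ` V \<union> (\<Union>e\<in>S. arc_interior (\<gamma> e))"
proof
  fix x assume "x \<in> drawing S"
  then obtain e where e: "e \<in> S" "x \<in> path_image (\<gamma> e)" unfolding drawing_def by blast
  show "x \<in> p ` V \<union> (\<Union>e\<in>S. arc_interior (\<gamma> e))"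
  proof (cases "x \<in> p ` e")
    case True
    then show ?thesis using edge_subset e(1) assms by blast
  next
    case False
    then have "x \<in> arc_interior (\<gamma> e)" using arc_interior_edge e assms by blast
    then show ?thesis using e(1) by blast
  qed
qed

section \<open>Incidences between faces and edges\<close>

text \<open>Induction removes an edge \<open>e\<close> with an end in no other edge of
  \<open>S\<close>. Its arc meets the rest in at most one point, and neither the arc nor the rest
  separates the plane, so by Janiszewski's theorem their union does not either.\<close>

lemma few_edges_no_separation:
  assumes "bipartite_graph V E" "S \<subseteq> E" "card S \<le> 3"
  shows "connected (- drawing S)"
  using assms(2,3)
proof (induction "card S" arbitrary: S)
  case 0
  then have "S = {}" using finite_subset_E by auto
  then show ?case by (simp add: convex_connected)
next
  case (Suc n)
  then have S: "finite S" "S \<noteq> {}" using finite_subset_E by auto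
  obtain A B where AB: "A \<inter> B = {}" "\<forall>e\<in>E. \<exists>a\<in>A. \<exists>b\<in>B. e = {a, b}"
    using assms(1) unfolding bipartite_graph_def by auto
  have "\<forall>e\<in>S. \<exists>a\<in>A. \<exists>b\<in>B. e = {a, b}"
    using AB(2) Suc.prems(1) by (meson subsetD)
  from bipartite_three_edges_leaf[OF S Suc.prems(2) AB(1) this]
  obtain e x where e: "e \<in> S" "x \<in> e" "x \<notin> \<Union>(S - {e})"
    by blast
  have eE: "e \<in> E" and sub: "S - {e} \<subseteq> E" using e Suc.prems by auto
  obtain y where y: "e = {x, y}"
    using simple_graph_edgeE[OF simple eE e(2)] .
  have "e \<inter> \<Union>(S - {e}) \<subseteq> {y}" using e(3) y by auto
  then have "path_image (\<gamma> e) \<inter> drawing (S - {e}) \<subseteq> {p y}"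
    using edge_Int_drawing[OF eE sub] by auto
  then have "connected (path_image (\<gamma> e) \<inter> drawing (S - {e}))"
    by (metis connected_empty connected_sing subset_singletonD)
  moreover have "connected (- drawing (S - {e}))"
    using Suc e(1) S sub by (intro Suc.hyps(1)) auto
  moreover have "connected (- path_image (\<gamma> e))"
    using connected_arc_complement[OF edge_arc(1)[OF eE]] by simp
  ultimately have "connected (- (path_image (\<gamma> e) \<union> drawing (S - {e})))"
    using Janiszewski_connected edge_compact[OF eE] compact_drawing[OF sub] compact_imp_closed
    by blast
  then show ?case using e(1) by (metis drawing_insert insert_Diff)
qed

text \<open>The frontier of a face lies on the drawing, so it consists of vertex points and of
  interior points of edges that are incident with the face by definition. The vertex points are kept
  in the smaller drawing because incidence does not record them.\<close>

lemma face_in_own_drawing: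
  assumes "W \<in> faces" "V \<subseteq> \<Union>E"
  shows "W \<in> components (- (p ` V \<union> drawing (face_edges W)))"
proof (rule component_avoiding_frontier)
  show "W \<in> components (- drawing E)" using assms(1) unfolding faces_def .
  have "p ` V \<subseteq> drawing E"
    using assms(2) ends_in_edge unfolding drawing_def by blast
  then show "p ` V \<union> drawing (face_edges W) \<subseteq> drawing E"
    unfolding drawing_def face_edges_def by blast
  have "frontier W \<subseteq> frontier (- drawing E)"
    using assms(1) frontier_of_components_subset unfolding faces_def by blast
  also have "\<dots> \<subseteq> drawing E"
    using compact_drawing[of E] by (simp add: compact_imp_closed frontier_subset_closed)
  finally have "frontier W \<subseteq> p ` V \<union> (\<Union>e\<in>E. arc_interior (\<gamma> e))"
    using drawing_eq_interiors[of E] by blast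
  moreover have "x \<in> drawing (face_edges W)"
    if "x \<in> frontier W" "x \<in> arc_interior (\<gamma> e)" "e \<in> E" for x e
  proof -
    have "e \<in> face_edges W" using that unfolding face_edges_def by blast
    moreover have "x \<in> path_image (\<gamma> e)" using that(2) unfolding arc_interior_def by blast
    ultimately show ?thesis unfolding drawing_def by blast
  qed
  ultimately show "frontier W \<subseteq> p ` V \<union> drawing (face_edges W)" by blast
qed

text \<open>With at most three incident edges, \<open>W\<close> would be a component of the plane
  minus at most three arcs and finitely many points. That set is connected, so \<open>W\<close>
  would be all of it and would swallow \<open>W'\<close>. The second face is essential: a single
  edge has one face and one incidence.\<close>

lemma face_at_least_four_edges:
  assumes "bipartite_graph V E" "V \<subseteq> \<Union>E" "W \<in> faces" "W' \<in> faces" "W \<noteq> W'"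
  shows "card (face_edges W) \<ge> 4"
proof (rule ccontr)
  let ?S = "face_edges W"
  have S: "?S \<subseteq> E" unfolding face_edges_def by blast
  assume "\<not> ?thesis"
  then have "connected (- drawing ?S)"
    using few_edges_no_separation[OF assms(1) S] by simp
  moreover have "open (- drawing ?S)"
    using compact_drawing[OF S] compact_imp_closed by blast
  ultimately have "connected (- drawing ?S - p ` V)"
    using connected_open_delete_finite finite_V by (metis DIM_complex finite_imageI order_refl)
  then have con: "connected (- (p ` V \<union> drawing ?S))"
    by (simp add: Diff_eq Int_commute)
  have W: "W \<in> components (- (p ` V \<union> drawing ?S))"
    using face_in_own_drawing assms(2,3) by blast
  have "W \<noteq> {}" "W \<subseteq> - (p ` V \<union> drawing ?S)"
    using W in_components_nonempty in_components_subset by blast+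
  then have "- (p ` V \<union> drawing ?S) \<subseteq> W"
    using components_maximal[OF W con order_refl] by (simp add: Int_absorb2)
  moreover have "p ` V \<union> drawing ?S \<subseteq> drawing E"
    using S assms(2) ends_in_edge unfolding drawing_def by blast
  moreover have "W' \<subseteq> - drawing E"
    using assms(4) in_components_subset unfolding faces_def by blast
  ultimately have "W' \<subseteq> W" by blast
  moreover have "W \<inter> W' = {}" "W' \<noteq> {}"
    using assms(3-5) components_nonoverlap in_components_nonempty unfolding faces_def by blast+
  ultimately show False by blast
qed

text \<open>Without \<open>e\<close>, every face incident with \<open>e\<close> lies in the one
  component \<open>F\<close> that contains the interior of its arc, since the frontier of the face
  meets the open set \<open>F\<close>. Points of three such faces are thus connected before the arc
  is added, and adding it leaves two of them connected.\<close>

lemma edge_at_most_two_faces: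
  assumes e: "e \<in> E"
  shows "finite {W \<in> faces. e \<in> face_edges W} \<and> card {W \<in> faces. e \<in> face_edges W} \<le> 2"
proof (rule card_le_2I)
  let ?\<K> = "(\<lambda>f. path_image (\<gamma> f)) ` (E - {e})"
  have KD: "\<Union>?\<K> = drawing (E - {e})" by (simp add: drawing_def)
  have KE: "drawing (E - {e}) \<union> path_image (\<gamma> e) = drawing E"
    using e unfolding drawing_def by blast
  have K: "finite ?\<K>" "\<And>C. C \<in> ?\<K> \<Longrightarrow> compact C" "\<And>C. C \<in> ?\<K> \<Longrightarrow> path_connected C"
    using finite_E edge_compact edge_path_connected by auto
  have int: "path_image (\<gamma> e) \<inter> drawing (E - {e}) \<subseteq> {pathstart (\<gamma> e), pathfinish (\<gamma> e)}"
    using edge_Int_others[OF e, of "E - {e}"] by blast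
  obtain F where F: "F \<in> components (- drawing (E - {e}))" "arc_interior (\<gamma> e) \<subseteq> F"
    using arc_interior_in_component[OF edge_arc(1)[OF e] int] .
  have "closed (drawing (E - {e}))"
    using compact_drawing[of "E - {e}"] compact_imp_closed by blast
  then have "open F" using F(1) open_components open_Compl by blast
  have in_F: "W \<subseteq> F" if W: "W \<in> faces" "e \<in> face_edges W" for W
  proof (rule components_maximal[OF F(1)])
    show "connected W" using W(1) in_components_connected unfolding faces_def by blast
    show "W \<subseteq> - drawing (E - {e})"
      using W(1) in_components_subset KE unfolding faces_def by blast
    obtain x where "x \<in> frontier W" "x \<in> F"
      using W(2) F(2) unfolding face_edges_def by blast
    then have "F \<inter> closure W \<noteq> {}" unfolding frontier_def by blast
    then show "F \<inter> W \<noteq> {}" using open_Int_closure_eq_empty[OF \<open>open F\<close>] by blast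
  qed
  fix W1 W2 W3
  assume W: "W1 \<in> {W \<in> faces. e \<in> face_edges W}" "W2 \<in> {W \<in> faces. e \<in> face_edges W}"
    "W3 \<in> {W \<in> faces. e \<in> face_edges W}"
  then obtain a b c where abc: "a \<in> W1" "b \<in> W2" "c \<in> W3"
    using in_components_nonempty unfolding faces_def by blast
  have F3: "a \<in> F" "b \<in> F" "c \<in> F" using abc W in_F by blast+
  have "connected F" "F \<subseteq> - drawing (E - {e})"
    using F(1) in_components_connected in_components_subset by blast+
  then have conn: "connected_component (- drawing (E - {e})) a b"
      "connected_component (- drawing (E - {e})) a c"
    unfolding connected_component_def using F3 by blast+
  have off: "a \<notin> drawing E" "b \<notin> drawing E" "c \<notin> drawing E"
    using abc W in_components_subset unfolding faces_def by blast+
  then have offe: "a \<notin> path_image (\<gamma> e)" "b \<notin> path_image (\<gamma> e)" "c \<notin> path_image (\<gamma> e)"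
    using KE by blast+
  have same: "X = Y" if "connected_component (- drawing E) x y" "x \<in> X" "y \<in> Y"
    "X \<in> faces" "Y \<in> faces" for X Y x y
    using that joinable_components_eq unfolding faces_def connected_component_def
    by (metis disjoint_iff)
  have "connected_component (- drawing E) a b \<or> connected_component (- drawing E) a c \<or>
      connected_component (- drawing E) b c"
    using arc_at_most_two_sides[OF K edge_arc(1)[OF e], of a b c] int conn offe
    unfolding KD KE by simp
  then show "W1 = W2 \<or> W1 = W3 \<or> W2 = W3"
    using same abc W by blast
qed

lemma face_edge_double_count:
  assumes "bipartite_graph V E" "V \<subseteq> \<Union>E" "W \<in> faces" "W' \<in> faces" "W \<noteq> W'"
  shows "finite faces" "2 * card faces \<le> card E"
proof -
  have four: "card (face_edges X) \<ge> 4" if "X \<in> faces" for X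
    using face_at_least_four_edges[OF assms(1,2) that] assms(3-5) by blast
  \<comment> \<open>Finiteness comes first: each face has at least one incident edge, and each edge
    is incident with finitely many faces.\<close>
  have "faces \<subseteq> (\<Union>e\<in>E. {W \<in> faces. e \<in> face_edges W})"
  proof
    fix X assume X: "X \<in> faces"
    then have "face_edges X \<noteq> {}" using four by fastforce
    then show "X \<in> (\<Union>e\<in>E. {W \<in> faces. e \<in> face_edges W})"
      using X unfolding face_edges_def by blast
  qed
  moreover have "finite (\<Union>e\<in>E. {W \<in> faces. e \<in> face_edges W})"
    using finite_E edge_at_most_two_faces by blast
  ultimately show fin: "finite faces" using finite_subset by blast
  have eq: "{e \<in> E. e \<in> face_edges X} = face_edges X" for X
    unfolding face_edges_def by blast
  have "4 * card faces = (\<Sum>X\<in>faces. 4)" by simp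
  also have "\<dots> \<le> (\<Sum>X\<in>faces. card (face_edges X))"
    using four by (intro sum_mono) auto
  also have "\<dots> = (\<Sum>X\<in>faces. \<Sum>e | e \<in> E \<and> e \<in> face_edges X. 1)"
    by (simp add: eq)
  also have "\<dots> = (\<Sum>e\<in>E. \<Sum>X | X \<in> faces \<and> e \<in> face_edges X. 1)"
    using sum.swap_restrict[OF fin finite_E] by fast
  also have "\<dots> \<le> (\<Sum>e\<in>E. 2)"
    using edge_at_most_two_faces by (intro sum_mono) simp
  finally show "2 * card faces \<le> card E" by simp
qed

section \<open>Euler's inequality for the number of faces\<close>

text \<open>The tree grows by an edge leaving the vertex set reached so far. It is recorded through
  its edge count and its path-connected drawing, which is how the face count uses it.\<close>

lemma spanning_tree:
  assumes "connected_graph V E"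
  obtains T where "T \<subseteq> E" "card T + 1 = card V" "path_connected (p ` V \<union> drawing T)"
proof -
  have V: "V \<noteq> {}" using assms unfolding connected_graph_def by simp
  \<comment> \<open>\<open>U\<close> is the set of vertices reached after \<open>k\<close> steps;
    \<open>\<Union>T \<subseteq> U\<close> ensures that an edge leaving \<open>U\<close> is
    new.\<close>
  have "\<exists>U T. U \<subseteq> V \<and> T \<subseteq> E \<and> \<Union>T \<subseteq> U \<and> card U = Suc k \<and> card T = k \<and>
      path_connected (p ` U \<union> drawing T)" if "Suc k \<le> card V" for k
    using that
  proof (induction k)
    case 0
    obtain v where "v \<in> V" using V by blast
    then show ?case by (intro exI[of _ "{v}"] exI[of _ "{}"]) simp
  next
    case (Suc k)
    then obtain U T where UT: "U \<subseteq> V" "T \<subseteq> E" "\<Union>T \<subseteq> U" "card U = Suc k" "card T = k"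
        "path_connected (p ` U \<union> drawing T)" by auto
    have "U \<noteq> {}" "U \<noteq> V" using UT(4) Suc.prems by auto
    then obtain x y where xy: "{x, y} \<in> E" "x \<in> U" "y \<in> V - U"
      using connected_graph_edge_leaving[OF simple assms UT(1)] by blast
    let ?e = "{x, y}"
    have "?e \<notin> T" using UT(3) xy by blast
    have ends: "p x \<in> path_image (\<gamma> ?e)" "p y \<in> path_image (\<gamma> ?e)"
      using ends_in_edge[OF xy(1)] by auto
    have "path_connected ((p ` U \<union> drawing T) \<union> path_image (\<gamma> ?e))"
    proof (rule path_connected_Un[OF UT(6) edge_path_connected[OF xy(1)]])
      show "(p ` U \<union> drawing T) \<inter> path_image (\<gamma> ?e) \<noteq> {}"
        using ends(1) xy(2) by blast
    qed
    moreover have "(p ` U \<union> drawing T) \<union> path_image (\<gamma> ?e) =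
        p ` insert y U \<union> drawing (insert ?e T)"
      using ends by auto
    ultimately have "path_connected (p ` insert y U \<union> drawing (insert ?e T))" by simp
    moreover have "card (insert y U) = Suc (Suc k)"
      using UT(1,4) xy(3) finite_V finite_subset by (metis DiffD2 card_insert_disjoint)
    moreover have "card (insert ?e T) = Suc k"
      using UT(2,5) \<open>?e \<notin> T\<close> finite_subset_E by simp
    moreover have "insert y U \<subseteq> V" "insert ?e T \<subseteq> E" "\<Union>(insert ?e T) \<subseteq> insert y U"
      using UT xy by auto
    ultimately show ?case by blast
  qed
  moreover have "card V = Suc (card V - 1)"
    using V finite_V by (metis One_nat_def Suc_pred card_gt_0_iff)
  ultimately obtain U T where "U \<subseteq> V" "T \<subseteq> E" "card U = card V" "card T = card V - 1"
        "path_connected (p ` U \<union> drawing T)"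
    by (metis order_refl)
  then show ?thesis
    using that card_subset_eq[OF finite_V] \<open>card V = Suc (card V - 1)\<close>
    by (metis Suc_eq_plus1)
qed

text \<open>A compact drawing leaves at least one component. Each further edge has its ends joined
  in the drawing, so its arc splits the component \<open>F\<close> through which it runs. Counting
  in a finite family \<open>\<W>\<close> avoids any claim about the number of all
  components.\<close>

lemma extra_edges_add_components:
  assumes "T \<subseteq> E" "path_connected (p ` V \<union> drawing T)" "D \<subseteq> E - T"
  shows "path_connected (p ` V \<union> drawing (T \<union> D)) \<and>
    (\<exists>\<W>\<subseteq>components (- (p ` V \<union> drawing (T \<union> D))). finite \<W> \<and> card \<W> \<ge> card D + 1)"
proof -
  have "finite D" using assms(3) finite_subset_E by blast
  then show ?thesis
    using assms(3)
  proof induction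
    case empty
    have "compact (p ` V \<union> drawing T)"
      using compact_drawing[OF assms(1)] finite_V finite_imp_compact by blast
    then have "- (p ` V \<union> drawing T) \<noteq> {}"
      using not_compact_UNIV by (metis Compl_empty_eq double_complement)
    then obtain W where "W \<in> components (- (p ` V \<union> drawing T))"
      using components_eq_empty by blast
    then show ?case using assms(2) by (intro conjI exI[of _ "{W}"]) auto
  next
    case (insert e D)
    let ?K = "p ` V \<union> drawing (T \<union> D)"
    let ?K' = "p ` V \<union> drawing (T \<union> insert e D)"
    have K': "?K' = ?K \<union> path_image (\<gamma> e)" by (auto simp: drawing_def)
    have e: "e \<in> E" "T \<union> D \<subseteq> E" "e \<notin> T \<union> D" using insert assms(1) by auto
    obtain \<W> where pc: "path_connected ?K" and
      \<W>: "\<W> \<subseteq> components (- ?K)" "finite \<W>" "card \<W> \<ge> card D + 1"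
      using insert by auto
    have "p ` e \<subseteq> ?K" using edge_subset[OF e(1)] by blast
    then have ends: "{pathstart (\<gamma> e), pathfinish (\<gamma> e)} \<subseteq> ?K" using edge_arc(2)[OF e(1)] by simp
    then have pcomp: "path_component ?K (pathstart (\<gamma> e)) (pathfinish (\<gamma> e))"
      using pc path_connected_component by (metis insert_subset)
    have clK: "closed ?K"
      using compact_drawing[OF e(2)] finite_V by (simp add: closed_Un compact_imp_closed finite_imp_closed)
    note int = edge_Int_others[OF e]
    obtain F where F: "F \<in> components (- ?K)" "arc_interior (\<gamma> e) \<subseteq> F"
      using arc_interior_in_component[OF edge_arc(1)[OF e(1)] int] .
    obtain W W' where W: "W \<noteq> W'" "W \<subseteq> F" "W' \<subseteq> F"
      "W \<in> components (- ?K')" "W' \<in> components (- ?K')"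
      using arc_separates_component[OF clK edge_arc(1)[OF e(1)] int pcomp F] unfolding K' .
    \<comment> \<open>The arc runs inside \<open>?K \<union> F\<close>, so components other than
      \<open>F\<close> are untouched.\<close>
    have keep: "X \<in> components (- ?K')" "X \<inter> F = {}" if X: "X \<in> \<W> - {F}" for X
    proof -
      show disj: "X \<inter> F = {}"
        using X \<W>(1) F(1) components_nonoverlap by blast
      have Xc: "X \<in> components (- ?K)" using X \<W>(1) by blast
      have sub: "X \<subseteq> - ?K'"
      proof -
        have "path_image (\<gamma> e) \<subseteq> ?K \<union> F"
          using F(2) ends unfolding arc_interior_def by blast
        moreover have "X \<subseteq> - ?K" using Xc in_components_subset by blast
        moreover have "X \<subseteq> - F" using disj by (simp add: disjoint_eq_subset_Compl)
        ultimately show ?thesis unfolding K' by blast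
      qed
      show "X \<in> components (- ?K')"
        unfolding in_components_maximal
      proof (intro conjI allI impI)
        show "X \<noteq> {}" "connected X" "X \<subseteq> - ?K'"
          using Xc sub in_components_nonempty in_components_connected by blast+
        fix Y assume Y: "Y \<noteq> {} \<and> X \<subseteq> Y \<and> Y \<subseteq> - ?K' \<and> connected Y"
        then have "Y \<subseteq> - ?K" unfolding K' by blast
        then show "Y = X" using Xc Y unfolding in_components_maximal by blast
      qed
    qed
    \<comment> \<open>At most one member, \<open>F\<close>, is lost, whether or not it belonged to
      \<open>\<W>\<close>, and two are gained. \<open>W\<close> and \<open>W'\<close> are new, being
      nonempty subsets of \<open>F\<close>.\<close>
    let ?\<W> = "insert W (insert W' (\<W> - {F}))"
    have "W \<noteq> {}" "W' \<noteq> {}" using W(4,5) in_components_nonempty by blast+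
    then have "W \<notin> \<W> - {F}" "W' \<notin> \<W> - {F}" using keep(2) W(2,3) by blast+
    then have "card ?\<W> = Suc (Suc (card (\<W> - {F})))" using \<W>(2) W(1) by simp
    moreover have "card (insert e D) = Suc (card D)" using insert.hyps by simp
    moreover have "card \<W> \<le> Suc (card (\<W> - {F}))"
      using diff_card_le_card_Diff[of "{F}" \<W>] by simp
    ultimately have "card ?\<W> \<ge> card (insert e D) + 1" using \<W>(3) by linarith
    moreover have "?\<W> \<subseteq> components (- ?K')" "finite ?\<W>"
      using W keep(1) \<W>(2) by blast+
    moreover have "path_connected ?K'"
      unfolding K'
    proof (rule path_connected_Un[OF pc edge_path_connected[OF e(1)]])
      show "?K \<inter> path_image (\<gamma> e) \<noteq> {}"
        using ends pathstart_in_path_image[of "\<gamma> e"] by auto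
    qed
    ultimately show ?case by blast
  qed
qed

text \<open>One half of Euler's formula, written additively to avoid truncated subtraction: the
  \<open>card E - card V + 1\<close> edges outside a spanning tree each add a face to the first
  one.\<close>

lemma euler_lower_bound:
  assumes "connected_graph V E" "V \<subseteq> \<Union>E"
  obtains \<W> where "\<W> \<subseteq> faces" "finite \<W>" "card \<W> + card V \<ge> card E + 2"
proof -
  obtain T where T: "T \<subseteq> E" "card T + 1 = card V" "path_connected (p ` V \<union> drawing T)"
    using spanning_tree[OF assms(1)] .
  have "p ` V \<union> drawing (T \<union> (E - T)) = drawing E"
    using T(1) assms(2) ends_in_edge unfolding drawing_def by blast
  then obtain \<W> where \<W>: "\<W> \<subseteq> faces" "finite \<W>" "card \<W> \<ge> card (E - T) + 1"
    using extra_edges_add_components[OF T(1,3), of "E - T"] unfolding faces_def by auto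
  moreover have "card E = card T + card (E - T)"
    using T(1) finite_E by (metis card_Diff_subset card_mono finite_subset le_add_diff_inverse)
  ultimately show ?thesis using that T(2) by force
qed

lemma bipartite_edge_bound:
  assumes "connected_graph V E" "bipartite_graph V E" "card V \<ge> 3"
  shows "card E + 4 \<le> 2 * card V"
proof -
  have cover: "V \<subseteq> \<Union>E"
  proof
    fix v assume "v \<in> V"
    moreover have "{v} \<noteq> V" using assms(3) by auto
    ultimately show "v \<in> \<Union>E"
      using connected_graph_edge_leaving[OF simple assms(1), of "{v}"] by blast
  qed
  obtain \<W> where \<W>: "\<W> \<subseteq> faces" "finite \<W>" "card \<W> + card V \<ge> card E + 2"
    using euler_lower_bound[OF assms(1) cover] .
  show ?thesis
  \<comment> \<open>The bound of four edges per face needs two faces. With at most one face in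
    \<open>\<W>\<close>, Euler's inequality gives \<open>card E + 1 \<le> card V\<close>, which
    suffices as \<open>card V \<ge> 3\<close>.\<close>
  proof (cases "card \<W> \<le> 1")
    case True
    then show ?thesis using \<W>(3) assms(3) by linarith
  next
    case False
    then obtain W W' where W: "W \<in> faces" "W' \<in> faces" "W \<noteq> W'"
      using \<W>(1,2) by (metis card_le_Suc0_iff_eq One_nat_def subsetD)
    note dc = face_edge_double_count[OF assms(2) cover W]
    have "card \<W> \<le> card faces" using card_mono[OF dc(1) \<W>(1)] .
    then show ?thesis using dc(2) \<W>(3) by linarith
  qed
qed

end

section \<open>Counting the vertices of degree three\<close>

theorem theorem7:
  fixes V :: "'a set" and E :: "'a set set" and n\<^sub>3 :: nat
  assumes "planar_brace V E"
    and "card V \<ge> 6"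
    and "n\<^sub>3 = card {v \<in> V. vertex_degree E v = 3}"
  shows "n\<^sub>3 \<ge> 8"
proof -
  have brace: "brace V E" and planar: "planar_graph V E"
    using assms(1) unfolding planar_brace_def by auto
  have G: "simple_graph V E" "connected_graph V E" "bipartite_graph V E"
    using brace unfolding brace_def matching_covered_def by auto
  obtain p \<gamma> where "plane_embedding V E p \<gamma>"
    using planar unfolding planar_graph_def by blast
  then interpret plane_graph V E p \<gamma>
    using G(1) by unfold_locales
  have edges: "card E + 4 \<le> 2 * card V"
    using bipartite_edge_bound[OF G(2,3)] assms(2) by simp
  let ?T = "{v \<in> V. vertex_degree E v = 3}"
  have "4 * card V = (\<Sum>v\<in>V. 4)" by simp
  \<comment> \<open>Degrees are at least three, so adding 1 at each vertex of degree exactly three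
    raises every term to at least four.\<close>
  also have "\<dots> \<le> (\<Sum>v\<in>V. vertex_degree E v + (if vertex_degree E v = 3 then 1 else 0))"
    using brace_min_degree[OF brace assms(2)] by (intro sum_mono) fastforce
  also have "\<dots> = 2 * card E + card ?T"
    using handshake[OF G(1)] finite_V by (simp add: sum.distrib flip: sum.inter_filter)
  finally show ?thesis using edges assms(3) by linarith
qed

end
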